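(* Assume that $f_1,\dots,f_n:\mathbb{R}\to\mathbb{R}$ are convex and $L$-smooth. Let $\boldsymbol{w}_\star\in\mathcal{C}$ be a minimizer of $\boldsymbol{w}\mapsto f(\boldsymbol{X}\boldsymbol{w})$ over $\mathcal{C}$, let $(\boldsymbol{w}_t,\boldsymbol{\alpha}_t)$ be generated by the Stochastic Frank-Wolfe algorithm (defined in the context, with step sizes $\gamma_t = 2/(t+2)$), let $H_0 = \|\boldsymbol{\alpha}_0-\nabla f(\boldsymbol{X}\boldsymbol{w}_0)\|_1$, and let $\varepsilon_t = f(\boldsymbol{X}\boldsymbol{w}_t)-f(\boldsymbol{X}\boldsymbol{w}_\star)$ for $t\ge 0$. Then for every $t\ge 2$, $$\mathbb{E}\,\varepsilon_t \;\le\; 2L\left(\frac{D_2^2+4(n-1)D_1D_\infty}{n}\right)\frac{t}{(t+1)(t+2)} + \frac{2\varepsilon_0+(2D_\infty H_0+64\,L D_1D_\infty)\,n^2}{(t+1)(t+2)}.$$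
   Context: Setting: $n,d\ge 1$ are integers, $\mathcal{C}\subset\mathbb{R}^d$ is a nonempty compact convex set, and $\boldsymbol{X}\in\mathbb{R}^{n\times d}$ is a matrix with rows $\boldsymbol{x}_1^\top,\dots,\boldsymbol{x}_n^\top$. Given functions $f_i:\mathbb{R}\to\mathbb{R}$, define $f:\mathbb{R}^n\to\mathbb{R}$ by $f(\boldsymbol{\theta})=\frac1n\sum_{i=1}^n f_i(\boldsymbol{\theta}_i)$. A function $h:\mathbb{R}\to\mathbb{R}$ is $L$-smooth if it is differentiable and $|h'(z)-h'(z')|\le L|z-z'|$ for all $z,z'$. Diameters: $D_p=\max_{\boldsymbol{u},\boldsymbol{v}\in\mathcal{C}}\|\boldsymbol{X}(\boldsymbol{u}-\boldsymbol{v})\|_p$ for $p\in\{1,2,\infty\}$. $\mathrm{LMO}(\boldsymbol{u})$ denotes an (arbitrarily selected) element of $\arg\min_{\boldsymbol{s}\in\mathcal{C}}\langle\boldsymbol{s},\boldsymbol{u}\rangle$. Stochastic Frank-Wolfe algorithm: fix $\boldsymbol{w}_0\in\mathcal{C}$, $\boldsymbol{\alpha}_0\in\mathbb{R}^n$, $\boldsymbol{r}_0=\boldsymbol{X}^\top\boldsymbol{\alpha}_0$ (deterministic). For $t=1,2,\dots$: sample $i\in\{1,\dots,n\}$ uniformly at random, independently of the past; set $\boldsymbol{\alpha}_t^{(i)}=\frac1n f_i'(\boldsymbol{x}_i^\top\boldsymbol{w}_{t-1})$ and $\boldsymbol{\alpha}_t^{(j)}=\boldsymbol{\alpha}_{t-1}^{(j)}$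 for $j\ne i$; set $\boldsymbol{r}_t=\boldsymbol{r}_{t-1}+(\boldsymbol{\alpha}_t^{(i)}-\boldsymbol{\alpha}_{t-1}^{(i)})\boldsymbol{x}_i$; set $\boldsymbol{s}_t=\mathrm{LMO}(\boldsymbol{r}_t)$; set $\boldsymbol{w}_t=\boldsymbol{w}_{t-1}+\gamma_t(\boldsymbol{s}_t-\boldsymbol{w}_{t-1})$ with $\gamma_t=\frac{2}{t+2}$. Here $\boldsymbol{\alpha}^{(i)}$ is the $i$-th coordinate of $\boldsymbol{\alpha}$. $\mathbb{E}$ is the full expectation over all sampled indices. *)

theory Defs
  imports "HOL-Probability.Probability"
begin

definition smooth :: "real \<Rightarrow> (real \<Rightarrow> real) \<Rightarrow> bool" where
  "smooth L h \<longleftrightarrow>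
     (\<forall>z. h differentiable (at z)) \<and> (\<forall>z z'. \<bar>deriv h z - deriv h z'\<bar> \<le> L * \<bar>z - z'\<bar>)"

definition l1_norm :: "real ^ 'n \<Rightarrow> real" where
  "l1_norm x = (\<Sum>i\<in>UNIV. \<bar>x $ i\<bar>)"

(* Used with l1_norm, norm and infnorm for N.  For nonempty compact C the supremum
   is attained, so it is the maximum over C. *)
definition diam :: "(real ^ 'n \<Rightarrow> real) \<Rightarrow> real ^ 'd ^ 'n \<Rightarrow> (real ^ 'd) set \<Rightarrow> real" where
  "diam N X C = (SUP (u, v) \<in> C \<times> C. N (X *v (u - v)))"

definition finite_sum :: "('n \<Rightarrow> real \<Rightarrow> real) \<Rightarrow> real ^ 'n \<Rightarrow> real" where
  "finite_sum f \<theta> = (1 / real CARD('n)) * (\<Sum>i\<in>UNIV. f i (\<theta> $ i))"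

(* The gradient is unique where it exists; the value is meaningful only at points
   of differentiability. *)
definition grad :: "('a::real_inner \<Rightarrow> real) \<Rightarrow> 'a \<Rightarrow> 'a" where
  "grad F x = (THE g. GDERIV F x :> g)"

definition is_lmo :: "'a::real_inner set \<Rightarrow> ('a \<Rightarrow> 'a) \<Rightarrow> bool" where
  "is_lmo C lmo \<longleftrightarrow> (\<forall>u. is_arg_min (\<lambda>s. s \<bullet> u) (\<lambda>s. s \<in> C) (lmo u))"

definition step_size :: "nat \<Rightarrow> real" where
  "step_size t = 2 / (real t + 2)"

(* The triple (w_t, alpha_t, r_t) along a fixed realisation idx of the sampled indices;
   idx t is the index drawn in iteration t >= 1, so idx 0 is never used. *)
primrec sfw ::
  "('n \<Rightarrow> real \<Rightarrow> real) \<Rightarrow> real ^ 'd ^ 'n \<Rightarrow> (real ^ 'd \<Rightarrow> real ^ 'd) \<Rightarrow>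
   real ^ 'd \<Rightarrow> real ^ 'n \<Rightarrow> (nat \<Rightarrow> 'n) \<Rightarrow> nat \<Rightarrow> (real ^ 'd) \<times> (real ^ 'n) \<times> (real ^ 'd)"
where
  "sfw f X lmo w0 \<alpha>0 idx 0 = (w0, \<alpha>0, transpose X *v \<alpha>0)"
| "sfw f X lmo w0 \<alpha>0 idx (Suc t) =
     (let (w, \<alpha>, r) = sfw f X lmo w0 \<alpha>0 idx t;
          i = idx (Suc t);
          \<alpha>' = (\<chi> j. if j = i then (1 / real CARD('n)) * deriv (f i) (row i X \<bullet> w) else \<alpha> $ j);
          r' = r + (\<alpha>' $ i - \<alpha> $ i) *\<^sub>R row i X;
          s = lmo r';
          w' = w + step_size (Suc t) *\<^sub>R (s - w)
      in (w', \<alpha>', r'))"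

definition sfw_w ::
  "('n \<Rightarrow> real \<Rightarrow> real) \<Rightarrow> real ^ 'd ^ 'n \<Rightarrow> (real ^ 'd \<Rightarrow> real ^ 'd) \<Rightarrow>
   real ^ 'd \<Rightarrow> real ^ 'n \<Rightarrow> (nat \<Rightarrow> 'n) \<Rightarrow> nat \<Rightarrow> real ^ 'd"
where
  "sfw_w f X lmo w0 \<alpha>0 idx t = fst (sfw f X lmo w0 \<alpha>0 idx t)"

definition subopt ::
  "('n \<Rightarrow> real \<Rightarrow> real) \<Rightarrow> real ^ 'd ^ 'n \<Rightarrow> real ^ 'd \<Rightarrow> real ^ 'd \<Rightarrow> real"
where
  "subopt f X wstar w = finite_sum f (X *v w) - finite_sum f (X *v wstar)"

(* Independent uniform draws in iterations 1, 2, ...; since everything else in the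
   algorithm is deterministic, mutual independence is independence of the past. *)
definition uniform_samples :: "'a measure \<Rightarrow> (nat \<Rightarrow> 'a \<Rightarrow> 'n) \<Rightarrow> bool" where
  "uniform_samples M I \<longleftrightarrow> prob_space M \<and>
     prob_space.indep_vars M (\<lambda>_. count_space UNIV) I {1..} \<and>
     (\<forall>t\<ge>1. distr M (count_space UNIV) (I t) = uniform_count_measure UNIV)"

end

theory Submission
  imports Defs
begin

text \<open>
  Write \<open>R\<^sub>k\<close> for the expected 1-norm distance between the gradient table \<open>\<alpha>\<^sub>k\<close> and the gradient of
  \<open>f\<close> at \<open>X w\<^sub>k\<close>, and \<open>e\<^sub>k\<close> for the expected suboptimality of \<open>w\<^sub>k\<close>. Two inequalities couple them.

  The usual Frank-Wolfe argument combines the quadratic upper bound from smoothness, the linear lower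
  bound from convexity and the optimality of the oracle. Here the oracle sees the table in place of
  the gradient. Pairing the error of the table with a difference of two points of \<open>X C\<close> costs at
  most \<open>D\<^sub>\<infinity>\<close> times its 1-norm, and the refresh that precedes the oracle call shrinks that 1-norm by
  the factor \<open>1 - 1 / n\<close> on average. This gives \<open>expectation_gap_Suc_le\<close>:
  \<open>e\<^sub>k\<^sub>+\<^sub>1 \<le> (1 - \<gamma>) e\<^sub>k + \<gamma> D\<^sub>\<infinity> (1 - 1/n) R\<^sub>k + \<gamma>\<^sup>2 L D\<^sub>2\<^sup>2 / (2 n)\<close> with \<open>\<gamma> = 2 / (k + 3)\<close>.

  The step to \<open>w\<^sub>k\<^sub>+\<^sub>1\<close> then displaces the gradient by at most \<open>\<gamma> L D\<^sub>1 / n\<close> in 1-norm, which gives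
  \<open>expectation_table_error_Suc_le\<close>: \<open>R\<^sub>k\<^sub>+\<^sub>1 \<le> (1 - 1/n) R\<^sub>k + \<gamma> L D\<^sub>1 / n\<close>. The factor \<open>1 - 1 / n\<close>
  is the probability that a given coordinate is not refreshed, and it comes out of the expectation
  because the new index is independent of the past (\<open>expectation_unless_next_index\<close>).

  The recursion is solved in \<open>coupled_recursion_bound\<close> with the potential
  \<open>(k + 1) (k + 2) e\<^sub>k + 2 D\<^sub>\<infinity> (n - 1) (k + 1 + n) R\<^sub>k\<close>. The first weight turns \<open>1 - \<gamma> = (k + 1) / (k + 3)\<close>
  into a telescoping factor. The second one is the total influence of \<open>R\<^sub>k\<close> on all later gaps, so that
  the terms in \<open>R\<close> cancel exactly and only the inhomogeneous terms are left to add up.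
\<close>

section \<open>Norms, diameters and gradients of separable functions\<close>

lemma l1_norm_nonneg: "0 \<le> l1_norm x"
  by (simp add: l1_norm_def sum_nonneg)

lemma l1_norm_triangle: "l1_norm (x + y) \<le> l1_norm x + l1_norm y"
  by (simp add: l1_norm_def flip: sum.distrib) (intro sum_mono abs_triangle_ineq)

lemma continuous_on_l1_norm: "continuous_on A l1_norm"
  unfolding l1_norm_def by (intro continuous_intros)

lemma abs_inner_le_l1_norm_infnorm: "\<bar>x \<bullet> y\<bar> \<le> l1_norm x * infnorm y"
proof -
  have "\<bar>x \<bullet> y\<bar> \<le> (\<Sum>i\<in>UNIV. \<bar>x $ i\<bar> * \<bar>y $ i\<bar>)"
    by (simp add: inner_vec_def sum_abs flip: abs_mult)
  also have "\<dots> \<le> (\<Sum>i\<in>UNIV. \<bar>x $ i\<bar> * infnorm y)"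
    by (intro sum_mono mult_left_mono component_le_infnorm_cart) auto
  finally show ?thesis by (simp add: l1_norm_def sum_distrib_right)
qed

lemma norm_le_diam:
  assumes "compact C" "continuous_on UNIV N" "u \<in> C" "v \<in> C"
  shows "N (X *v (u - v)) \<le> diam N X C"
proof -
  have "continuous_on (C \<times> C) (\<lambda>(u, v). N (X *v (u - v)))"
    unfolding case_prod_beta
    by (intro continuous_on_compose2[OF assms(2)] continuous_intros
        linear_continuous_on_compose[OF _ matrix_vector_mul_linear]) auto
  then have "compact ((\<lambda>(u, v). N (X *v (u - v))) ` (C \<times> C))"
    using assms(1) by (intro compact_continuous_image compact_Times)
  then have "bdd_above ((\<lambda>(u, v). N (X *v (u - v))) ` (C \<times> C))"
    by (intro bounded_imp_bdd_above compact_imp_bounded)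
  from cSUP_upper[OF _ this, of "(u, v)"] assms(3,4) show ?thesis
    by (simp add: diam_def)
qed

lemma smooth_imp_DERIV: "smooth L h \<Longrightarrow> (h has_real_derivative deriv h z) (at z)"
  by (simp add: smooth_def DERIV_deriv_iff_real_differentiable)

text \<open>The Lipschitz constant of a derivative on the line is nonnegative because the line has two
  distinct points.\<close>
lemma smooth_imp_nonneg:
  assumes "smooth L h" shows "0 \<le> L"
proof -
  have "\<bar>deriv h 1 - deriv h 0\<bar> \<le> L * \<bar>1 - 0\<bar>"
    using assms unfolding smooth_def by blast
  then show ?thesis by simp
qed

text \<open>As a function of \<open>b\<close>, the left side minus the right side has its maximum at \<open>b = a\<close>: the
  Lipschitz bound makes it nondecreasing to the left of \<open>a\<close> and nonincreasing to the right.\<close>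
lemma smooth_descent:
  assumes "smooth L h"
  shows "h b \<le> h a + deriv h a * (b - a) + L / 2 * (b - a)\<^sup>2"
proof -
  define g where "g x = h x - deriv h a * x - L / 2 * (x - a)\<^sup>2" for x
  have der: "(g has_real_derivative (deriv h x - deriv h a - L * (x - a))) (at x)" for x
    unfolding g_def by (auto intro!: derivative_eq_intros smooth_imp_DERIV[OF assms])
  have lip: "\<bar>deriv h x - deriv h a\<bar> \<le> L * \<bar>x - a\<bar>" for x
    using assms by (simp add: smooth_def)
  have "g b \<le> g a"
  proof (cases "a \<le> b")
    case True
    show ?thesis
    proof (rule DERIV_nonpos_imp_nonincreasing[OF True])
      fix x assume "a \<le> x" "x \<le> b"
      with lip[of x] have "deriv h x - deriv h a - L * (x - a) \<le> 0" by (simp add: abs_le_iff)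
      with der[of x] show "\<exists>y. DERIV g x :> y \<and> y \<le> 0" by blast
    qed
  next
    case False
    then have "b \<le> a" by simp
    then show ?thesis
    proof (rule DERIV_nonneg_imp_nondecreasing)
      fix x assume "b \<le> x" "x \<le> a"
      with lip[of x] have "0 \<le> deriv h x - deriv h a - L * (x - a)"
        by (simp add: abs_le_iff algebra_simps)
      with der[of x] show "\<exists>y. DERIV g x :> y \<and> 0 \<le> y" by blast
    qed
  qed
  then show ?thesis by (simp add: g_def algebra_simps)
qed

lemma grad_eqI:
  assumes "GDERIV F x :> g" shows "grad F x = g"
  unfolding grad_def
proof (rule the_equality)
  show "GDERIV F x :> g" by (rule assms)
next
  fix g' assume "GDERIV F x :> g'"
  then have "(\<lambda>h. h \<bullet> g') = (\<lambda>h. h \<bullet> g)"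
    using assms unfolding gderiv_def by (rule has_derivative_unique)
  then show "g' = g" by (simp add: fun_eq_iff vector_eq_ldot)
qed

lemma grad_finite_sum:
  fixes f :: "'n::finite \<Rightarrow> real \<Rightarrow> real"
  assumes "\<And>i. smooth L (f i)"
  shows "grad (finite_sum f) \<theta> = (\<chi> i. 1 / real CARD('n) * deriv (f i) (\<theta> $ i))"
proof (rule grad_eqI)
  have "((\<lambda>\<theta>. f i (\<theta> $ i)) has_derivative (\<lambda>h. deriv (f i) (\<theta> $ i) * h $ i)) (at \<theta>)" for i
    using smooth_imp_DERIV[OF assms] unfolding has_field_derivative_def
    by (rule has_derivative_compose[OF bounded_linear_imp_has_derivative[OF bounded_linear_vec_nth]])
  then have "(finite_sum f has_derivative
      (\<lambda>h. 1 / real CARD('n) * (\<Sum>i\<in>UNIV. deriv (f i) (\<theta> $ i) * h $ i))) (at \<theta>)"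
    unfolding finite_sum_def by (intro has_derivative_mult_right has_derivative_sum)
  also have "(\<lambda>h. 1 / real CARD('n) * (\<Sum>i\<in>UNIV. deriv (f i) (\<theta> $ i) * h $ i))
      = (\<lambda>h. h \<bullet> (\<chi> i. 1 / real CARD('n) * deriv (f i) (\<theta> $ i)))"
    by (simp add: fun_eq_iff inner_vec_def sum_distrib_left mult_ac)
  finally show "GDERIV (finite_sum f) \<theta> :> (\<chi> i. 1 / real CARD('n) * deriv (f i) (\<theta> $ i))"
    unfolding gderiv_def .
qed

lemma finite_sum_descent:
  fixes f :: "'n::finite \<Rightarrow> real \<Rightarrow> real"
  assumes "\<And>i. smooth L (f i)"
  shows "finite_sum f \<eta> \<le> finite_sum f \<theta> + grad (finite_sum f) \<theta> \<bullet> (\<eta> - \<theta>)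
           + L / (2 * real CARD('n)) * (norm (\<eta> - \<theta>))\<^sup>2"
proof -
  have "finite_sum f \<eta> \<le> (1 / real CARD('n)) * (\<Sum>i\<in>UNIV. f i (\<theta> $ i)
      + deriv (f i) (\<theta> $ i) * (\<eta> $ i - \<theta> $ i) + L / 2 * (\<eta> $ i - \<theta> $ i)\<^sup>2)"
    unfolding finite_sum_def
    by (intro mult_left_mono sum_mono smooth_descent[OF assms]) auto
  also have "\<dots> = finite_sum f \<theta> + grad (finite_sum f) \<theta> \<bullet> (\<eta> - \<theta>)
           + L / (2 * real CARD('n)) * (norm (\<eta> - \<theta>))\<^sup>2"
    by (simp add: finite_sum_def grad_finite_sum[OF assms] power2_norm_eq_inner inner_vec_def
        sum.distrib sum_divide_distrib sum_distrib_left add_divide_distrib power2_eq_square[of "_ - _"])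
  finally show ?thesis .
qed

lemma finite_sum_above_tangent:
  fixes f :: "'n::finite \<Rightarrow> real \<Rightarrow> real"
  assumes "\<And>i. smooth L (f i)" "\<And>i. convex_on UNIV (f i)"
  shows "finite_sum f \<theta> + grad (finite_sum f) \<theta> \<bullet> (\<eta> - \<theta>) \<le> finite_sum f \<eta>"
proof -
  have tangent: "deriv (f i) a * (b - a) \<le> f i b - f i a" for i and a b :: real
    using convex_on_imp_above_tangent[OF assms(2), where c = a and x = b]
      smooth_imp_DERIV[OF assms(1), of i a] by simp
  have "finite_sum f \<theta> + grad (finite_sum f) \<theta> \<bullet> (\<eta> - \<theta>)
      = (1 / real CARD('n)) * (\<Sum>i\<in>UNIV. f i (\<theta> $ i) + deriv (f i) (\<theta> $ i) * (\<eta> $ i - \<theta> $ i))"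
    by (simp add: finite_sum_def grad_finite_sum[OF assms(1)] inner_vec_def
        sum.distrib sum_divide_distrib add_divide_distrib)
  also have "\<dots> \<le> finite_sum f \<eta>"
    unfolding finite_sum_def
    using tangent by (intro mult_left_mono sum_mono) (auto simp: algebra_simps)
  finally show ?thesis .
qed

lemma l1_norm_grad_finite_sum_diff:
  fixes f :: "'n::finite \<Rightarrow> real \<Rightarrow> real"
  assumes "\<And>i. smooth L (f i)"
  shows "l1_norm (grad (finite_sum f) \<theta> - grad (finite_sum f) \<eta>)
           \<le> L / real CARD('n) * l1_norm (\<theta> - \<eta>)"
proof -
  have "\<bar>(grad (finite_sum f) \<theta> - grad (finite_sum f) \<eta>) $ i\<bar>
      \<le> L / real CARD('n) * \<bar>(\<theta> - \<eta>) $ i\<bar>" for i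
  proof -
    have "\<bar>(grad (finite_sum f) \<theta> - grad (finite_sum f) \<eta>) $ i\<bar>
        = 1 / real CARD('n) * \<bar>deriv (f i) (\<theta> $ i) - deriv (f i) (\<eta> $ i)\<bar>"
      by (simp add: grad_finite_sum[OF assms] flip: diff_divide_distrib)
    also have "\<dots> \<le> 1 / real CARD('n) * (L * \<bar>\<theta> $ i - \<eta> $ i\<bar>)"
      using assms by (intro mult_left_mono) (auto simp: smooth_def)
    finally show ?thesis by simp
  qed
  then show ?thesis
    unfolding l1_norm_def sum_distrib_left by (rule sum_mono)
qed

section \<open>Progress of one iteration along a fixed sample path\<close>

locale stochastic_frank_wolfe =
  fixes f :: "'n::finite \<Rightarrow> real \<Rightarrow> real"
    and X :: "real ^ 'd::finite ^ 'n"
    and C :: "(real ^ 'd) set"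
    and L :: real
    and lmo :: "real ^ 'd \<Rightarrow> real ^ 'd"
    and w0 wstar :: "real ^ 'd"
    and \<alpha>0 :: "real ^ 'n"
  assumes compact_C: "compact C" and convex_C: "convex C"
    and convex_f: "\<And>i. convex_on UNIV (f i)" and smooth_f: "\<And>i. smooth L (f i)"
    and wstar_in: "wstar \<in> C" and lmo: "is_lmo C lmo" and w0_in: "w0 \<in> C"
begin

abbreviation "gradF \<theta> \<equiv> grad (finite_sum f) \<theta>"
abbreviation "D1 \<equiv> diam l1_norm X C"
abbreviation "D2 \<equiv> diam norm X C"
abbreviation "Dinf \<equiv> diam infnorm X C"

abbreviation "iter idx k \<equiv> sfw_w f X lmo w0 \<alpha>0 idx k"

text \<open>The vector \<open>\<alpha>\<^sub>k\<close>, which starts as \<open>\<alpha>0\<close> and collects outdated partial derivatives of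
  \<open>finite_sum f\<close>, each from the last iteration that drew its index.\<close>
definition "table idx k = fst (snd (sfw f X lmo w0 \<alpha>0 idx k))"
definition "gap idx k = subopt f X wstar (iter idx k)"

text \<open>Iteration \<open>k + 1\<close> refreshes the table and calls the oracle before it moves the iterate. The
  oracle therefore works with the new table, whose error is to be measured at the old iterate.\<close>
definition "table_error idx k = l1_norm (table idx k - gradF (X *v iter idx k))"
definition "oracle_error idx k = l1_norm (table idx (Suc k) - gradF (X *v iter idx k))"

lemmas diam_bounds =
  norm_le_diam[OF compact_C continuous_on_l1_norm]
  norm_le_diam[OF compact_C continuous_on_norm_id]
  norm_le_diam[OF compact_C continuous_on_infnorm[OF continuous_on_id]]

lemma L_nonneg: "0 \<le> L"
  using smooth_f by (rule smooth_imp_nonneg)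

lemma D1_nonneg: "0 \<le> D1"
  using l1_norm_nonneg diam_bounds(1)[OF w0_in w0_in] by (rule order_trans)

lemma Dinf_nonneg: "0 \<le> Dinf"
  using infnorm_pos_le diam_bounds(3)[OF w0_in w0_in] by (rule order_trans)

lemma iter_0: "iter idx 0 = w0"
  by (simp add: sfw_w_def)

lemma table_0: "table idx 0 = \<alpha>0"
  by (simp add: table_def)

lemma gradF_nth: "gradF (X *v w) $ j = 1 / real CARD('n) * deriv (f j) (row j X \<bullet> w)"
  by (simp add: grad_finite_sum[OF smooth_f] matrix_vector_mul_component row_def)

lemma table_Suc:
  "table idx (Suc k) =
     (\<chi> j. if j = idx (Suc k) then gradF (X *v iter idx k) $ j else table idx k $ j)"
  unfolding gradF_nth by (auto simp: table_def sfw_w_def Let_def case_prod_beta vec_eq_iff)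

text \<open>The algorithm maintains \<open>r\<close> by rank-one updates; it always is the direction that the current
  table induces in weight space.\<close>
lemma dual_vector_eq: "snd (snd (sfw f X lmo w0 \<alpha>0 idx k)) = transpose X *v table idx k"
proof (induction k)
  case 0
  show ?case by (simp add: table_def)
next
  case (Suc k)
  let ?i = "idx (Suc k)"
  have "table idx (Suc k) = table idx k
      + (table idx (Suc k) $ ?i - table idx k $ ?i) *\<^sub>R axis ?i 1"
    by (simp add: table_Suc vec_eq_iff axis_def)
  then have "transpose X *v table idx (Suc k) = transpose X *v table idx k
      + (table idx (Suc k) $ ?i - table idx k $ ?i) *\<^sub>R row ?i X"
    by (metis matrix_vector_right_distrib matrix_vector_mult_scaleR matrix_vector_mult_basis
        column_transpose)
  with Suc show ?case
    by (simp add: table_def Let_def case_prod_beta)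
qed

lemma iter_Suc:
  "iter idx (Suc k) = iter idx k
     + step_size (Suc k) *\<^sub>R (lmo (transpose X *v table idx (Suc k)) - iter idx k)"
  by (subst dual_vector_eq[symmetric]) (simp add: sfw_w_def Let_def case_prod_beta)

lemma lmo_in: "lmo u \<in> C" and lmo_le: "s \<in> C \<Longrightarrow> lmo u \<bullet> u \<le> s \<bullet> u"
  using lmo[unfolded is_lmo_def is_arg_min_linorder, rule_format, of u] by simp_all

lemma step_size_bounds: "0 \<le> step_size k" "step_size k \<le> 1"
  by (auto simp: step_size_def)

lemma iter_in: "iter idx k \<in> C"
proof (induction k)
  case (Suc k)
  have "(1 - step_size (Suc k)) *\<^sub>R iter idx k
      + step_size (Suc k) *\<^sub>R lmo (transpose X *v table idx (Suc k)) \<in> C"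
    using convex_C Suc lmo_in step_size_bounds by (intro convexD) auto
  then show ?case by (simp add: iter_Suc algebra_simps)
qed (simp add: iter_0 w0_in)

text \<open>The oracle is optimal for the direction given by the table instead of the gradient. Compared
  with moving towards \<open>wstar\<close>, this costs the pairing of the table error with \<open>X (s - wstar)\<close>.
  Both \<open>s\<close> and \<open>wstar\<close> lie in \<open>C\<close>, so Hoelder's inequality bounds the cost with a single
  diameter.\<close>
lemma gap_Suc_le:
  "gap idx (Suc k) \<le> (1 - step_size (Suc k)) * gap idx k
     + step_size (Suc k) * (Dinf * oracle_error idx k)
     + (step_size (Suc k))\<^sup>2 * (L / (2 * real CARD('n)) * D2\<^sup>2)"
proof -
  define \<gamma> where "\<gamma> = step_size (Suc k)"
  define w where "w = iter idx k"
  define \<alpha> where "\<alpha> = table idx (Suc k)"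
  define s where "s = lmo (transpose X *v \<alpha>)"
  define g where "g = gradF (X *v w)"
  have in_C: "w \<in> C" "s \<in> C" by (auto simp: w_def s_def iter_in lmo_in)
  have step: "X *v iter idx (Suc k) - X *v w = \<gamma> *\<^sub>R (X *v (s - w))"
    by (simp add: iter_Suc w_def s_def \<alpha>_def \<gamma>_def matrix_vector_right_distrib
        matrix_vector_mult_scaleR)
  have "\<alpha> \<bullet> (X *v s) \<le> \<alpha> \<bullet> (X *v wstar)"
    using lmo_le[OF wstar_in, of "transpose X *v \<alpha>"]
    by (simp add: s_def dot_lmul_matrix[symmetric] vector_transpose_matrix inner_commute)
  then have "g \<bullet> (X *v (s - w)) \<le> g \<bullet> (X *v wstar - X *v w) + (g - \<alpha>) \<bullet> (X *v (s - wstar))"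
    by (simp add: matrix_vector_mult_diff_distrib algebra_simps)
  also have "g \<bullet> (X *v wstar - X *v w) \<le> - gap idx k"
    using finite_sum_above_tangent[where f = f, OF smooth_f convex_f, where \<theta> = "X *v w" and \<eta> = "X *v wstar"]
    by (simp add: gap_def subopt_def g_def w_def)
  also have "(g - \<alpha>) \<bullet> (X *v (s - wstar)) \<le> Dinf * oracle_error idx k"
  proof -
    have "(g - \<alpha>) \<bullet> (X *v (s - wstar)) \<le> l1_norm (g - \<alpha>) * infnorm (X *v (s - wstar))"
      using abs_inner_le_l1_norm_infnorm by (rule order_trans[OF abs_ge_self])
    also have "\<dots> \<le> l1_norm (g - \<alpha>) * Dinf"
      using diam_bounds(3)[OF in_C(2) wstar_in] by (intro mult_left_mono l1_norm_nonneg)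
    also have "l1_norm (g - \<alpha>) = oracle_error idx k"
      by (simp add: oracle_error_def l1_norm_def g_def w_def \<alpha>_def abs_minus_commute)
    finally show ?thesis by (simp add: mult.commute)
  qed
  finally have dir: "g \<bullet> (X *v (s - w)) \<le> - gap idx k + Dinf * oracle_error idx k" by simp
  have sq: "(norm (X *v (s - w)))\<^sup>2 \<le> D2\<^sup>2"
    using diam_bounds(2)[OF in_C(2,1)] by (intro power_mono) auto
  have "gap idx (Suc k) \<le> gap idx k + \<gamma> * (g \<bullet> (X *v (s - w)))
      + \<gamma>\<^sup>2 * (L / (2 * real CARD('n)) * (norm (X *v (s - w)))\<^sup>2)"
    using finite_sum_descent[where f = f, OF smooth_f, where \<eta> = "X *v iter idx (Suc k)" and \<theta> = "X *v w"]
    by (simp add: gap_def subopt_def step g_def power_mult_distrib mult_ac flip: w_def)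
  also have "\<dots> \<le> gap idx k + \<gamma> * (- gap idx k + Dinf * oracle_error idx k)
      + \<gamma>\<^sup>2 * (L / (2 * real CARD('n)) * D2\<^sup>2)"
    using dir sq L_nonneg step_size_bounds(1)
    by (intro add_mono mult_left_mono) (auto simp: \<gamma>_def)
  finally show ?thesis by (simp add: \<gamma>_def algebra_simps)
qed

text \<open>One iteration moves \<open>X w\<close> in 1-norm by at most the step size times \<open>D1\<close>, so the gradient that the
  table has to track drifts by only \<open>L / n\<close> times that.\<close>
lemma table_error_Suc_le:
  "table_error idx (Suc k) \<le> oracle_error idx k + L * D1 / real CARD('n) * step_size (Suc k)"
proof -
  let ?w = "iter idx k" and ?w' = "iter idx (Suc k)" and ?\<gamma> = "step_size (Suc k)"
  define s where "s = lmo (transpose X *v table idx (Suc k))"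
  have move: "X *v ?w - X *v ?w' = ?\<gamma> *\<^sub>R (X *v (?w - s))"
    by (simp add: iter_Suc s_def matrix_vector_right_distrib matrix_vector_mult_diff_distrib
        matrix_vector_mult_scaleR scaleR_diff_right)
  have "l1_norm (?\<gamma> *\<^sub>R (X *v (?w - s))) = ?\<gamma> * l1_norm (X *v (?w - s))"
    using step_size_bounds(1) by (simp add: l1_norm_def abs_mult sum_distrib_left)
  also have "\<dots> \<le> ?\<gamma> * D1"
    using step_size_bounds(1) diam_bounds(1)[OF iter_in lmo_in]
    by (intro mult_left_mono) (auto simp: s_def)
  finally have "l1_norm (gradF (X *v ?w) - gradF (X *v ?w')) \<le> L / real CARD('n) * (?\<gamma> * D1)"
    using L_nonneg
    by (intro order_trans[OF l1_norm_grad_finite_sum_diff[OF smooth_f]] mult_left_mono)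
       (simp_all add: move)
  moreover have "table_error idx (Suc k)
      \<le> oracle_error idx k + l1_norm (gradF (X *v ?w) - gradF (X *v ?w'))"
    using l1_norm_triangle[of "table idx (Suc k) - gradF (X *v ?w)" "gradF (X *v ?w) - gradF (X *v ?w')"]
    by (simp add: table_error_def oracle_error_def)
  ultimately show ?thesis by (simp add: mult_ac)
qed

lemma oracle_error_eq:
  "oracle_error idx k = (\<Sum>i\<in>UNIV. if idx (Suc k) = i then 0
     else \<bar>table idx k $ i - gradF (X *v iter idx k) $ i\<bar>)"
  by (auto simp: oracle_error_def l1_norm_def table_Suc intro!: sum.cong)

lemma sfw_cong:
  "\<forall>j\<in>{1..k}. idx j = idx' j \<Longrightarrow>
     sfw f X lmo w0 \<alpha>0 idx k = sfw f X lmo w0 \<alpha>0 idx' k"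
proof (induction k)
  case (Suc k)
  have "sfw f X lmo w0 \<alpha>0 idx k = sfw f X lmo w0 \<alpha>0 idx' k"
    using Suc.prems by (intro Suc.IH) auto
  moreover have "idx (Suc k) = idx' (Suc k)"
    using Suc.prems by auto
  ultimately show ?case by simp
qed simp

end

section \<open>Averaging over the sampled indices\<close>

text \<open>The range starts at 1 because iterations, and with them the random draws, are counted from 1.\<close>
definition past_determined :: "nat \<Rightarrow> ((nat \<Rightarrow> 'n) \<Rightarrow> 'b) \<Rightarrow> bool" where
  "past_determined k g \<longleftrightarrow> (\<forall>idx idx'. (\<forall>j\<in>{1..k}. idx j = idx' j) \<longrightarrow> g idx = g idx')"

lemma past_determined_restrict:
  "past_determined k g \<Longrightarrow> g (restrict idx {1..k}) = g idx"
  unfolding past_determined_def by (metis restrict_apply')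

locale uniform_index_sampling =
  fixes M :: "'a measure" and I :: "nat \<Rightarrow> 'a \<Rightarrow> 'n::finite"
  assumes samples: "uniform_samples M I"

sublocale uniform_index_sampling \<subseteq> prob_space M
  using samples by (simp add: uniform_samples_def)

context uniform_index_sampling
begin

abbreviation "draws \<omega> \<equiv> (\<lambda>j. I j \<omega>)"

lemma indep_I: "indep_vars (\<lambda>_. count_space UNIV) I {1..}"
  using samples by (simp add: uniform_samples_def)

lemma measurable_I [measurable]: "1 \<le> j \<Longrightarrow> I j \<in> measurable M (count_space UNIV)"
  using indep_I unfolding indep_vars_def by simp

text \<open>A finite product of discrete spaces over a finite type is discrete.\<close>
lemma measurable_on_paths:
  assumes "finite J" "g \<in> PiE J (\<lambda>_. UNIV) \<rightarrow> space N"
  shows "g \<in> measurable (PiM J (\<lambda>_. count_space (UNIV :: 'n set))) N"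
  using assms by (subst count_space_PiM_finite) auto

text \<open>Finitely many indices have finitely many joint values, so \<open>g\<close> is bounded on them.\<close>
lemma integrable_past_determined:
  fixes g :: "(nat \<Rightarrow> 'n) \<Rightarrow> real"
  assumes "past_determined k g"
  shows "integrable M (\<lambda>\<omega>. g (draws \<omega>))"
proof -
  let ?E = "PiE {1..k} (\<lambda>_. UNIV :: 'n set)"
  have fin: "finite ?E" by (intro finite_PiE) auto
  have "(\<lambda>\<omega>. restrict (draws \<omega>) {1..k}) \<in> measurable M (PiM {1..k} (\<lambda>_. count_space UNIV))"
    by (intro measurable_restrict measurable_I) auto
  moreover have "g \<in> borel_measurable (PiM {1..k} (\<lambda>_. count_space UNIV))"
    by (rule measurable_on_paths) auto
  ultimately have "(\<lambda>\<omega>. g (restrict (draws \<omega>) {1..k})) \<in> borel_measurable M"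
    by (rule measurable_compose)
  moreover have "norm (g (restrict (draws \<omega>) {1..k})) \<le> Max ((\<lambda>p. norm (g p)) ` ?E)" for \<omega>
    using fin by (intro Max_ge finite_imageI imageI) auto
  ultimately have "integrable M (\<lambda>\<omega>. g (restrict (draws \<omega>) {1..k}))"
    by (intro integrable_const_bound[where B = "Max ((\<lambda>p. norm (g p)) ` ?E)"]) auto
  then show ?thesis by (simp only: past_determined_restrict[OF assms])
qed

lemma expectation_next_index_neq:
  "expectation (\<lambda>\<omega>. if I (Suc k) \<omega> = i then 0 else 1 :: real) = 1 - 1 / real CARD('n)"
proof -
  have "expectation (\<lambda>\<omega>. if I (Suc k) \<omega> = i then 0 else 1 :: real)
      = (\<integral>x. (if x = i then 0 else 1) \<partial>distr M (count_space UNIV) (I (Suc k)))"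
    by (subst integral_distr) auto
  also have "distr M (count_space UNIV) (I (Suc k)) = uniform_count_measure UNIV"
    using samples by (simp add: uniform_samples_def)
  also have "(\<integral>x. (if x = i then 0 else 1 :: real) \<partial>uniform_count_measure UNIV)
      = (\<Sum>x\<in>UNIV. 1 / real CARD('n) * (if x = i then 0 else 1))"
    unfolding uniform_count_measure_def
    by (subst lebesgue_integral_point_measure_finite) auto
  also have "\<dots> = (\<Sum>x\<in>UNIV. 1 / real CARD('n) - (if x = i then 1 / real CARD('n) else 0))"
    by (intro sum.cong) auto
  also have "\<dots> = 1 - 1 / real CARD('n)"
    by (simp add: sum_subtractf)
  finally show ?thesis .
qed

text \<open>A quantity fixed by the first \<open>k\<close> draws is independent of draw \<open>k + 1\<close>, which misses any
  given index with probability \<open>1 - 1 / n\<close>.\<close>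
lemma expectation_unless_next_index:
  fixes g :: "(nat \<Rightarrow> 'n) \<Rightarrow> real"
  assumes g: "past_determined k g"
  shows "expectation (\<lambda>\<omega>. if I (Suc k) \<omega> = i then 0 else g (draws \<omega>))
           = (1 - 1 / real CARD('n)) * expectation (\<lambda>\<omega>. g (draws \<omega>))"
proof -
  define h :: "(nat \<Rightarrow> 'n) \<Rightarrow> real" where "h = (\<lambda>p. if p (Suc k) = i then 0 else 1)"
  have h: "past_determined (Suc k) h" by (auto simp: past_determined_def h_def)
  have "indep_var (PiM {1..k} (\<lambda>_. count_space UNIV)) (\<lambda>\<omega>. restrict (draws \<omega>) {1..k})
      (PiM {Suc k} (\<lambda>_. count_space UNIV)) (\<lambda>\<omega>. restrict (draws \<omega>) {Suc k})"
    by (rule indep_var_restrict[OF indep_I]) auto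
  then have "indep_var borel (g \<circ> (\<lambda>\<omega>. restrict (draws \<omega>) {1..k}))
      borel (h \<circ> (\<lambda>\<omega>. restrict (draws \<omega>) {Suc k}))"
    by (rule indep_var_compose) (rule measurable_on_paths; simp)+
  moreover have "g \<circ> (\<lambda>\<omega>. restrict (draws \<omega>) {1..k}) = (\<lambda>\<omega>. g (draws \<omega>))"
    by (simp only: past_determined_restrict[OF g] comp_def)
  moreover have "h \<circ> (\<lambda>\<omega>. restrict (draws \<omega>) {Suc k}) = (\<lambda>\<omega>. h (draws \<omega>))"
    by (simp add: h_def fun_eq_iff)
  ultimately have "indep_var borel (\<lambda>\<omega>. g (draws \<omega>)) borel (\<lambda>\<omega>. h (draws \<omega>))"
    by simp
  then have "expectation (\<lambda>\<omega>. g (draws \<omega>) * h (draws \<omega>))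
      = expectation (\<lambda>\<omega>. g (draws \<omega>)) * expectation (\<lambda>\<omega>. h (draws \<omega>))"
    using integrable_past_determined[OF g] integrable_past_determined[OF h]
    by (rule indep_var_lebesgue_integral)
  moreover have "(\<lambda>\<omega>. g (draws \<omega>) * h (draws \<omega>))
      = (\<lambda>\<omega>. if I (Suc k) \<omega> = i then 0 else g (draws \<omega>))"
    by (simp add: h_def fun_eq_iff)
  moreover have "expectation (\<lambda>\<omega>. h (draws \<omega>)) = 1 - 1 / real CARD('n)"
    unfolding h_def by (rule expectation_next_index_neq)
  ultimately show ?thesis by simp
qed

end

locale sampled_frank_wolfe =
  stochastic_frank_wolfe f X C L lmo w0 wstar \<alpha>0 + uniform_index_sampling M I
  for f :: "'n::finite \<Rightarrow> real \<Rightarrow> real"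
    and X :: "real ^ 'd::finite ^ 'n"
    and C L lmo w0 wstar \<alpha>0
    and M :: "'a measure"
    and I :: "nat \<Rightarrow> 'a \<Rightarrow> 'n"
begin

lemma past_determined_errors:
  "past_determined k (\<lambda>idx. gap idx k)"
  "past_determined k (\<lambda>idx. table_error idx k)"
  "past_determined k (\<lambda>idx. \<bar>table idx k $ i - gradF (X *v iter idx k) $ i\<bar>)"
  unfolding past_determined_def gap_def table_error_def sfw_w_def table_def
  by (intro allI impI; drule sfw_cong; simp)+

lemma past_determined_oracle_error: "past_determined (Suc k) (\<lambda>idx. oracle_error idx k)"
  unfolding past_determined_def
proof (intro allI impI)
  fix idx idx' :: "nat \<Rightarrow> 'n"
  assume agree: "\<forall>j\<in>{1..Suc k}. idx j = idx' j"
  then have "\<forall>j\<in>{1..k}. idx j = idx' j" by simp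
  from sfw_cong[OF this] sfw_cong[OF agree] show "oracle_error idx k = oracle_error idx' k"
    unfolding oracle_error_def sfw_w_def table_def by (simp only:)
qed

lemmas integrable_errors [simp] =
  integrable_past_determined[OF past_determined_errors(1)]
  integrable_past_determined[OF past_determined_errors(2)]
  integrable_past_determined[OF past_determined_oracle_error]

text \<open>The refresh makes one uniformly chosen coordinate of the table exact and leaves the others
  alone.\<close>
lemma expectation_oracle_error:
  "expectation (\<lambda>\<omega>. oracle_error (draws \<omega>) k)
     = (1 - 1 / real CARD('n)) * expectation (\<lambda>\<omega>. table_error (draws \<omega>) k)"
proof -
  let ?e = "\<lambda>i \<omega>. \<bar>table (draws \<omega>) k $ i - gradF (X *v iter (draws \<omega>) k) $ i\<bar>"
  have int: "integrable M (?e i)" for i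
    by (rule integrable_past_determined[OF past_determined_errors(3)])
  have int': "integrable M (\<lambda>\<omega>. if I (Suc k) \<omega> = i then 0 else ?e i \<omega>)" for i
  proof (rule Bochner_Integration.integrable_bound[OF int])
    show "(\<lambda>\<omega>. if I (Suc k) \<omega> = i then 0 else ?e i \<omega>) \<in> borel_measurable M"
      using borel_measurable_integrable[OF int] by measurable
  qed auto
  have "expectation (\<lambda>\<omega>. oracle_error (draws \<omega>) k)
      = (\<Sum>i\<in>UNIV. expectation (\<lambda>\<omega>. if I (Suc k) \<omega> = i then 0 else ?e i \<omega>))"
    unfolding oracle_error_eq by (rule Bochner_Integration.integral_sum[OF int'])
  also have "\<dots> = (\<Sum>i\<in>UNIV. (1 - 1 / real CARD('n)) * expectation (?e i))"
    by (intro sum.cong refl expectation_unless_next_index past_determined_errors(3))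
  also have "\<dots> = (1 - 1 / real CARD('n)) * (\<Sum>i\<in>UNIV. expectation (?e i))"
    by (rule sum_distrib_left[symmetric])
  also have "(\<Sum>i\<in>UNIV. expectation (?e i)) = expectation (\<lambda>\<omega>. table_error (draws \<omega>) k)"
    unfolding table_error_def l1_norm_def vector_minus_component
    by (rule Bochner_Integration.integral_sum[OF int, symmetric])
  finally show ?thesis .
qed

lemma expectation_gap_Suc_le:
  "expectation (\<lambda>\<omega>. gap (draws \<omega>) (Suc k))
     \<le> (1 - step_size (Suc k)) * expectation (\<lambda>\<omega>. gap (draws \<omega>) k)
       + step_size (Suc k)
         * (Dinf * ((1 - 1 / real CARD('n)) * expectation (\<lambda>\<omega>. table_error (draws \<omega>) k)))
       + (step_size (Suc k))\<^sup>2 * (L / (2 * real CARD('n)) * D2\<^sup>2)"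
proof -
  have "expectation (\<lambda>\<omega>. gap (draws \<omega>) (Suc k))
      \<le> expectation (\<lambda>\<omega>. (1 - step_size (Suc k)) * gap (draws \<omega>) k
       + step_size (Suc k) * (Dinf * oracle_error (draws \<omega>) k)
       + (step_size (Suc k))\<^sup>2 * (L / (2 * real CARD('n)) * D2\<^sup>2))"
    by (intro integral_mono gap_Suc_le Bochner_Integration.integrable_add integrable_mult_right
        integrable_const) simp_all
  also have "\<dots> = (1 - step_size (Suc k)) * expectation (\<lambda>\<omega>. gap (draws \<omega>) k)
       + step_size (Suc k) * (Dinf * expectation (\<lambda>\<omega>. oracle_error (draws \<omega>) k))
       + (step_size (Suc k))\<^sup>2 * (L / (2 * real CARD('n)) * D2\<^sup>2)"
    by (simp add: prob_space)
  finally show ?thesis by (simp only: expectation_oracle_error)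
qed

lemma expectation_table_error_Suc_le:
  "expectation (\<lambda>\<omega>. table_error (draws \<omega>) (Suc k))
     \<le> (1 - 1 / real CARD('n)) * expectation (\<lambda>\<omega>. table_error (draws \<omega>) k)
       + L * D1 / real CARD('n) * step_size (Suc k)"
proof -
  have "expectation (\<lambda>\<omega>. table_error (draws \<omega>) (Suc k))
      \<le> expectation (\<lambda>\<omega>. oracle_error (draws \<omega>) k + L * D1 / real CARD('n) * step_size (Suc k))"
    by (intro integral_mono table_error_Suc_le Bochner_Integration.integrable_add integrable_const)
       simp_all
  then show ?thesis by (simp add: prob_space expectation_oracle_error)
qed

end

section \<open>Solving the coupled recursion\<close>

text \<open>Here \<open>e\<close>, \<open>R\<close>, \<open>D\<close> stand for the expected gap, the expected table error and \<open>Dinf\<close>. The proof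
  shows that a weighted sum of \<open>e\<close> and \<open>R\<close> grows only by the inhomogeneous terms.\<close>
lemma coupled_recursion_bound:
  fixes e R :: "nat \<Rightarrow> real"
  assumes n: "1 \<le> n" and B: "0 \<le> B" and c: "0 \<le> c" and D: "0 \<le> D"
    and R_nonneg: "\<And>k. 0 \<le> R k"
    and e: "\<And>k. e (Suc k) \<le> (1 - step_size (Suc k)) * e k
              + step_size (Suc k) * (D * ((1 - 1 / n) * R k)) + (step_size (Suc k))\<^sup>2 * B"
    and R: "\<And>k. R (Suc k) \<le> (1 - 1 / n) * R k + c * step_size (Suc k)"
  shows "(real t + 1) * (real t + 2) * e t
           \<le> 2 * e 0 + 2 * D * n\<^sup>2 * R 0 + 4 * B * real t + 4 * D * c * (n - 1) * (2 * real t + n\<^sup>2)"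
proof -
  have potential: "(real t + 1) * (real t + 2) * e t + 2 * D * (n - 1) * (real t + 1 + n) * R t
      \<le> 2 * e 0 + 2 * D * (n - 1) * (n + 1) * R 0 + 4 * B * real t
        + 4 * D * c * (n - 1) * (2 * real t + n\<^sup>2 * (1 - 1 / (real t + 1)))"
  proof (induction t)
    case 0
    show ?case by (simp add: algebra_simps)
  next
    case (Suc t)
    define k where "k = real t"
    have k: "0 \<le> k" by (simp add: k_def)
    have \<gamma>: "step_size (Suc t) = 2 / (k + 3)" by (simp add: step_size_def k_def)
    have "(k + 2) * (k + 3) * e (Suc t) \<le> (k + 2) * (k + 3) *
        ((1 - 2 / (k + 3)) * e t + 2 / (k + 3) * (D * ((1 - 1 / n) * R t)) + (2 / (k + 3))\<^sup>2 * B)"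
      using k e[of t, unfolded \<gamma>] by (intro mult_left_mono) auto
    also have "\<dots> = (k + 1) * (k + 2) * e t + 2 * (k + 2) * D * (1 - 1 / n) * R t
        + 4 * B * ((k + 2) / (k + 3))"
      using k n by (simp add: divide_simps power2_eq_square) algebra
    also have "\<dots> \<le> (k + 1) * (k + 2) * e t + 2 * (k + 2) * D * (1 - 1 / n) * R t + 4 * B * 1"
      using k B by (intro add_left_mono mult_left_mono) auto
    finally have e_step: "(k + 2) * (k + 3) * e (Suc t)
        \<le> (k + 1) * (k + 2) * e t + 2 * (k + 2) * D * (1 - 1 / n) * R t + 4 * B" by simp
    \<comment> \<open>The harmonic terms \<open>n / (k + 3)\<close> would sum to a logarithm. Completing a square trades each
      of them for a constant and a multiple of \<open>n\<^sup>2\<close> that telescopes.\<close>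
    have "x \<le> 1 + x\<^sup>2" for x :: real
      using zero_le_power2[of "x - 1 / 2"] by (simp add: power2_eq_square algebra_simps)
    then have "n / (k + 3) \<le> 1 + (n / (k + 3))\<^sup>2" .
    also have "(n / (k + 3))\<^sup>2 \<le> n\<^sup>2 * (1 / (k + 1) - 1 / (k + 2))"
    proof -
      have "1 / (k + 3)\<^sup>2 \<le> 1 / ((k + 1) * (k + 2))"
        using k by (intro divide_left_mono) (auto simp: power2_eq_square intro!: mult_mono)
      also have "\<dots> = 1 / (k + 1) - 1 / (k + 2)"
        using k by (simp add: divide_simps)
      finally have "n\<^sup>2 * (1 / (k + 3)\<^sup>2) \<le> n\<^sup>2 * (1 / (k + 1) - 1 / (k + 2))"
        by (rule mult_left_mono) simp
      then show ?thesis by (simp add: power_divide)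
    qed
    finally have "n / (k + 3) \<le> 1 + n\<^sup>2 * (1 / (k + 1) - 1 / (k + 2))" by simp
    moreover have "(k + 2) / (k + 3) \<le> 1" using k by simp
    ultimately have harmonic: "(k + 2 + n) / (k + 3) \<le> 2 + n\<^sup>2 * (1 / (k + 1) - 1 / (k + 2))"
      unfolding add_divide_distrib[of "k + 2" n] by linarith
    have "2 * D * (n - 1) * (k + 2 + n) * R (Suc t)
        \<le> 2 * D * (n - 1) * (k + 2 + n) * ((1 - 1 / n) * R t + c * (2 / (k + 3)))"
      using k n D R[of t, unfolded \<gamma>] by (intro mult_left_mono) auto
    also have "\<dots> = 2 * D * (n - 1) * (k + 2 + n) * (1 - 1 / n) * R t
        + 4 * D * c * (n - 1) * ((k + 2 + n) / (k + 3))"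
      by (subst distrib_left) (simp add: mult_ac)
    also have "\<dots> \<le> 2 * D * (n - 1) * (k + 2 + n) * (1 - 1 / n) * R t
        + 4 * D * c * (n - 1) * (2 + n\<^sup>2 * (1 / (k + 1) - 1 / (k + 2)))"
      using harmonic D c n by (intro add_left_mono mult_left_mono) auto
    finally have R_step: "2 * D * (n - 1) * (k + 2 + n) * R (Suc t)
        \<le> 2 * D * (n - 1) * (k + 2 + n) * (1 - 1 / n) * R t
          + 4 * D * c * (n - 1) * (2 + n\<^sup>2 * (1 / (k + 1) - 1 / (k + 2)))" .
    \<comment> \<open>The weights \<open>a k = (n - 1) * (k + 1 + n)\<close> solve \<open>a k = (1 - 1 / n) * (k + 2 + a (k + 1))\<close>:
      an error at time \<open>k\<close> first harms the next gap and then survives into the next error.\<close>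
    have "2 * (k + 2) * D * (1 - 1 / n) * R t + 2 * D * (n - 1) * (k + 2 + n) * (1 - 1 / n) * R t
        = 2 * D * R t * (((k + 2) + (n - 1) * (k + 2 + n)) * (1 - 1 / n))"
      by (simp add: algebra_simps)
    also have "((k + 2) + (n - 1) * (k + 2 + n)) * (1 - 1 / n) = (n - 1) * (k + 1 + n)"
      using n by (simp add: field_simps)
    finally have weight: "2 * (k + 2) * D * (1 - 1 / n) * R t
        + 2 * D * (n - 1) * (k + 2 + n) * (1 - 1 / n) * R t = 2 * D * (n - 1) * (k + 1 + n) * R t"
      by (simp only: mult_ac)
    have "(k + 2) * (k + 3) * e (Suc t) + 2 * D * (n - 1) * (k + 2 + n) * R (Suc t)
        \<le> ((k + 1) * (k + 2) * e t + 2 * D * (n - 1) * (k + 1 + n) * R t) + 4 * B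
          + 4 * D * c * (n - 1) * (2 + n\<^sup>2 * (1 / (k + 1) - 1 / (k + 2)))"
      using e_step R_step weight by linarith
    also have "\<dots> \<le> (2 * e 0 + 2 * D * (n - 1) * (n + 1) * R 0 + 4 * B * k
        + 4 * D * c * (n - 1) * (2 * k + n\<^sup>2 * (1 - 1 / (k + 1)))) + 4 * B
          + 4 * D * c * (n - 1) * (2 + n\<^sup>2 * (1 / (k + 1) - 1 / (k + 2)))"
      using Suc.IH by (simp add: k_def)
    also have "\<dots> = 2 * e 0 + 2 * D * (n - 1) * (n + 1) * R 0 + 4 * B * (k + 1)
        + 4 * D * c * (n - 1) * (2 * (k + 1) + n\<^sup>2 * (1 - 1 / (k + 2)))"
      by (simp add: algebra_simps)
    finally show ?case by (simp add: k_def add.commute add.left_commute)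
  qed
  have "0 \<le> 2 * D * (n - 1) * (real t + 1 + n) * R t"
    using D n R_nonneg by simp
  moreover have "2 * D * (n - 1) * (n + 1) * R 0 \<le> 2 * D * n\<^sup>2 * R 0"
    using D R_nonneg[of 0] by (intro mult_right_mono) (auto simp: power2_eq_square algebra_simps)
  moreover have "4 * D * c * (n - 1) * (2 * real t + n\<^sup>2 * (1 - 1 / (real t + 1)))
      \<le> 4 * D * c * (n - 1) * (2 * real t + n\<^sup>2)"
    using D c n by (intro mult_left_mono add_left_mono) (auto simp: mult_left_le)
  ultimately show ?thesis using potential by linarith
qed

theorem theorem1:
  fixes f :: "'n::finite \<Rightarrow> real \<Rightarrow> real"
    and X :: "real ^ 'd::finite ^ 'n"
    and C :: "(real ^ 'd) set"
    and L :: real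
    and lmo :: "real ^ 'd \<Rightarrow> real ^ 'd"
    and w0 wstar :: "real ^ 'd"
    and \<alpha>0 :: "real ^ 'n"
    and M :: "'a measure"
    and I :: "nat \<Rightarrow> 'a \<Rightarrow> 'n"
    and n D1 D2 Dinf H0 :: real
    and \<epsilon> :: "nat \<Rightarrow> 'a \<Rightarrow> real"
    and \<epsilon>0 :: real
    and t :: nat
  assumes "C \<noteq> {}" and "compact C" and "convex C"
    and "\<And>i. convex_on UNIV (f i)" and "\<And>i. smooth L (f i)"
    and "is_arg_min (\<lambda>w. finite_sum f (X *v w)) (\<lambda>w. w \<in> C) wstar"
    and "is_lmo C lmo"
    and "w0 \<in> C"
    and "uniform_samples M I"
    and "n = real CARD('n)"
    and "D1 = diam l1_norm X C" and "D2 = diam norm X C" and "Dinf = diam infnorm X C"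
    and "H0 = l1_norm (\<alpha>0 - grad (finite_sum f) (X *v w0))"
    and "\<And>k \<omega>. \<epsilon> k \<omega> = subopt f X wstar (sfw_w f X lmo w0 \<alpha>0 (\<lambda>j. I j \<omega>) k)"
    and "\<epsilon>0 = subopt f X wstar w0"
    and "t \<ge> 2"
  shows "prob_space.expectation M (\<epsilon> t)
    \<le> 2 * L * ((D2\<^sup>2 + 4 * (n - 1) * D1 * Dinf) / n) * (real t / ((real t + 1) * (real t + 2)))
      + (2 * \<epsilon>0 + (2 * Dinf * H0 + 64 * L * D1 * Dinf) * n\<^sup>2) / ((real t + 1) * (real t + 2))"
proof -
  interpret sampled_frank_wolfe f X C L lmo w0 wstar \<alpha>0 M I
    using assms(2-9) by unfold_locales (auto simp: is_arg_min_def)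
  have n: "1 \<le> n" using \<open>n = real CARD('n)\<close> by simp
  define e where "e k = expectation (\<lambda>\<omega>. gap (draws \<omega>) k)" for k
  define R where "R k = expectation (\<lambda>\<omega>. table_error (draws \<omega>) k)" for k
  define B where "B = L / (2 * n) * D2\<^sup>2"
  define c where "c = L * D1 / n"
  have nonneg: "0 \<le> L" "0 \<le> D1" "0 \<le> Dinf"
    using L_nonneg D1_nonneg Dinf_nonneg assms(11,13) by simp_all
  have e0: "e 0 = \<epsilon>0"
    using \<open>\<epsilon>0 = subopt f X wstar w0\<close> by (simp add: e_def gap_def iter_0 prob_space)
  have R0: "R 0 = H0"
    using assms(14) by (simp add: R_def table_error_def iter_0 table_0 prob_space)
  have "(real t + 1) * (real t + 2) * e t
      \<le> 2 * e 0 + 2 * Dinf * n\<^sup>2 * R 0 + 4 * B * real t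
        + 4 * Dinf * c * (n - 1) * (2 * real t + n\<^sup>2)"
  proof (rule coupled_recursion_bound[OF n])
    show "0 \<le> R k" for k
      unfolding R_def table_error_def by (intro Bochner_Integration.integral_nonneg l1_norm_nonneg)
    show "e (Suc k) \<le> (1 - step_size (Suc k)) * e k
        + step_size (Suc k) * (Dinf * ((1 - 1 / n) * R k)) + (step_size (Suc k))\<^sup>2 * B" for k
      unfolding e_def R_def B_def assms(10,12,13) by (rule expectation_gap_Suc_le)
    show "R (Suc k) \<le> (1 - 1 / n) * R k + c * step_size (Suc k)" for k
      unfolding R_def c_def assms(10,11) by (rule expectation_table_error_Suc_le)
  qed (use n nonneg in \<open>simp_all add: B_def c_def\<close>)
  also have "\<dots> = 2 * L * ((D2\<^sup>2 + 4 * (n - 1) * D1 * Dinf) / n) * real t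
      + (2 * \<epsilon>0 + 2 * Dinf * H0 * n\<^sup>2) + 4 * L * D1 * Dinf * (n * (n - 1))"
    using n by (simp add: e0 R0 B_def c_def field_simps power2_eq_square)
  \<comment> \<open>Only a factor of 4 arises here; the constant 64 of the statement leaves ample room.\<close>
  also have "4 * L * D1 * Dinf * (n * (n - 1)) \<le> 64 * L * D1 * Dinf * n\<^sup>2"
    using n nonneg by (intro mult_mono) (auto simp: power2_eq_square)
  finally have "(real t + 1) * (real t + 2) * e t
      \<le> 2 * L * ((D2\<^sup>2 + 4 * (n - 1) * D1 * Dinf) / n) * real t
        + (2 * \<epsilon>0 + (2 * Dinf * H0 + 64 * L * D1 * Dinf) * n\<^sup>2)"
    by (simp add: algebra_simps)
  then have "e t \<le> (2 * L * ((D2\<^sup>2 + 4 * (n - 1) * D1 * Dinf) / n) * real t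
        + (2 * \<epsilon>0 + (2 * Dinf * H0 + 64 * L * D1 * Dinf) * n\<^sup>2)) / ((real t + 1) * (real t + 2))"
    by (subst pos_le_divide_eq) (simp_all add: mult.commute)
  moreover have "\<epsilon> t = (\<lambda>\<omega>. gap (draws \<omega>) t)"
    using assms(15) by (simp add: gap_def fun_eq_iff)
  ultimately show ?thesis by (simp add: e_def add_divide_distrib)
qed

end
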